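(* Let $k \ge 1$ be an integer not of the form $(3s^2+1)/4$ with $s$ an odd integer, and let $H(a,b) = a^2 + ab + b^2$, which is the squared length of the vector $a\cdot 1 + b\cdot\omega_1$. Then for all integers $a, b$ with $H(a,b) = k$, the vector $(a,b,-a,-b)$ is a unit vector in $L_k$. The other unit vectors of $L_k$ are the $12$ vectors $(a,b,0,0)$ and $(0,0,c,d)$ with $a,b,c,d\in\mathbb{Z}$, $H(a,b) = 1$ and $H(c,d) = 1$ respectively. The number of solutions $(a,b)\in\mathbb{Z}^2$ of $H(a,b) = k$, i.e. the number of unit vectors of $L_k$ minus $12$, is unbounded as $k$ ranges over the admissible values (the integers $k\ge 1$ not of the form $(3s^2+1)/4$ with $s$ odd).
   Context: Identify $\mathbb{R}^2$ with $\mathbb{C}$. For an integer $k \ge 1$ let $$\omega_k = \frac{(2k-1) + i\sqrt{4k-1}}{2k} = e^{i\arccos(1 - 1/(2k))};$$ in particular $\omega_1 = \frac{1+i\sqrt{3}}{2}$ is a primitive 6th root of unity. Define $$L_k = \{a\cdot 1 + b\cdot\omega_1 + c\cdot\omega_k + d\cdot\omega_1\omega_k \mid a,b,c,d\in\mathbb{Z}\} \subset \mathbb{C}.$$ The values $k = 1, 7, 19, 37, 61, 91, \dots$, i.e. those with $4k-1 = 3s^2$ for an odd integer $s$, are excluded, since for them $L_k$ is only 2-dimensional (has rank 2 as a $\mathbb{Z}$-module); for all other $k\ge 1$ it is 4-dimensional (rank 4). The notation $(a,b,c,d)$ with $a,b,c,d\in\mathbb{Z}$ denotes the element $a\cdot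 1 + b\cdot\omega_1 + c\cdot\omega_k + d\cdot\omega_1\omega_k$ of $L_k$. A unit vector of $L_k$ is an element of $L_k$ of absolute value $1$. *)

theory Defs
  imports "HOL-Analysis.Analysis"
begin

definition \<omega> :: "nat \<Rightarrow> complex" where
  "\<omega> k = Complex ((2 * real k - 1) / (2 * real k)) (sqrt (4 * real k - 1) / (2 * real k))"

lemma omega_eq_cis_arccos:
  assumes "k \<ge> 1"
  shows "\<omega> k = cis (arccos (1 - 1 / (2 * real k)))"
proof -
  have k: "real k \<ge> 1" using assms by simp
  have "1 / (2 * real k) \<le> 1" using k by (simp add: field_simps)
  then have b: "-1 \<le> 1 - 1 / (2 * real k)" "1 - 1 / (2 * real k) \<le> 1" by auto
  have "1 - (1 - 1 / (2 * real k))\<^sup>2 = (4 * real k - 1) / (2 * real k)\<^sup>2"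
    using k by (simp add: field_simps power2_eq_square)
  then have "sqrt (1 - (1 - 1 / (2 * real k))\<^sup>2) = sqrt (4 * real k - 1) / (2 * real k)"
    using k by (simp only: real_sqrt_divide real_sqrt_abs)
  moreover have "1 - 1 / (2 * real k) = (2 * real k - 1) / (2 * real k)"
    using k by (simp add: field_simps)
  ultimately show ?thesis
    using b by (simp add: complex_eq_iff \<omega>_def sin_arccos)
qed

text \<open>The element of \<open>L k\<close> denoted by \<open>(a,b,c,d)\<close>.\<close>

definition vec4 :: "nat \<Rightarrow> int \<Rightarrow> int \<Rightarrow> int \<Rightarrow> int \<Rightarrow> complex" where
  "vec4 k a b c d =
     of_int a * 1 + of_int b * \<omega> 1 + of_int c * \<omega> k + of_int d * (\<omega> 1 * \<omega> k)"

definition L :: "nat \<Rightarrow> complex set" where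
  "L k = {vec4 k a b c d | a b c d. True}"

definition unit_vectors :: "nat \<Rightarrow> complex set" where
  "unit_vectors k = {z \<in> L k. cmod z = 1}"

definition H :: "int \<Rightarrow> int \<Rightarrow> int" where
  "H a b = a\<^sup>2 + a * b + b\<^sup>2"

text \<open>The equation \<open>k = (3s\<^sup>2 + 1)/4\<close> is multiplied out to stay within the integers.\<close>

definition admissible :: "nat \<Rightarrow> bool" where
  "admissible k \<longleftrightarrow> k \<ge> 1 \<and> \<not> (\<exists>s::int. odd s \<and> 4 * int k = 3 * s\<^sup>2 + 1)"

end

theory Submission
  imports Defs
begin

text \<open>
  Writing \<open>S = sqrt (3 (4k - 1))\<close>, the squared length of \<open>(a,b,c,d)\<close> times \<open>2k\<close> is
  \<open>H(a,b) + H(c,d) + (2k - 1) H(a+c,b+d) + (bc - ad) S\<close>. For admissible \<open>k\<close> the number \<open>S\<close> is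
  irrational, so a unit vector satisfies \<open>H(a,b) + H(c,d) + (2k - 1) H(a+c,b+d) = 2k\<close> with
  nonnegative summands, which forces \<open>H(a+c,b+d)\<close> to be \<open>0\<close> or \<open>1\<close>; the two values give the two
  families. For unboundedness, the ellipse \<open>H = 1\<close> has infinitely many rational points, and
  clearing an even common denominator \<open>D\<close> of many of them gives many solutions of \<open>H = D\<^sup>2\<close>,
  where \<open>D\<^sup>2\<close> is admissible because it is even.
\<close>

section \<open>The quadratic form \<open>H\<close>\<close>

lemma four_H: "4 * H a b = (2 * a + b)\<^sup>2 + 3 * b\<^sup>2"
  by (simp add: H_def power2_eq_square algebra_simps)

lemma H_commute: "H a b = H b a"
  by (simp add: H_def algebra_simps)

lemma H_nonneg: "0 \<le> H a b"
  using four_H[of a b] by (smt (verit) zero_le_power2)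

lemma H_eq_0_iff: "H a b = 0 \<longleftrightarrow> a = 0 \<and> b = 0"
proof
  assume "H a b = 0"
  with four_H[of a b] have "(2 * a + b)\<^sup>2 = 0" "b\<^sup>2 = 0"
    by (smt (verit) zero_le_power2)+
  then show "a = 0 \<and> b = 0" by simp
qed (simp add: H_def)

lemma H_minus: "H (- a) (- b) = H a b"
  by (simp add: H_def)

lemma H_scale: "H (t * a) (t * b) = t\<^sup>2 * H a b"
  by (simp add: H_def power2_eq_square algebra_simps)

text \<open>A crude bound that makes the level sets of \<open>H\<close> finite and
  \<open>H = 1\<close> a short enumeration. Small \<open>b\<close> is settled by definiteness,
  larger \<open>b\<close> by \<open>4 * \<bar>b\<bar> \<le> 3 * b^2\<close>.\<close>

lemma abs_le_H: "\<bar>b\<bar> \<le> H a b"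
proof -
  have "4 * \<bar>b\<bar> \<le> 4 * H a b"
  proof (cases "\<bar>b\<bar> \<le> 1")
    case True
    then have "b = 0 \<or> H a b \<noteq> 0" by (simp add: H_eq_0_iff)
    with True H_nonneg[of a b] show ?thesis by auto
  next
    case False
    then have "2 * \<bar>b\<bar> \<le> \<bar>b\<bar> * \<bar>b\<bar>" by (intro mult_right_mono) auto
    then have "4 * \<bar>b\<bar> \<le> 3 * b\<^sup>2"
      using False by (simp add: power2_eq_square)
    then show ?thesis using four_H[of a b] by (smt (verit) zero_le_power2)
  qed
  then show ?thesis by simp
qed

lemma finite_H_eq: "finite {(a, b). H a b = n}"
proof (rule finite_subset)
  show "{(a, b). H a b = n} \<subseteq> {-n..n} \<times> {-n..n}"
  proof clarsimp
    fix a b :: int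
    have "\<bar>a\<bar> \<le> H a b" "\<bar>b\<bar> \<le> H a b"
      using abs_le_H[of a b] abs_le_H[of b a] H_commute by auto
    then show "- H a b \<le> a \<and> a \<le> H a b \<and> - H a b \<le> b \<and> b \<le> H a b" by linarith
  qed
qed simp

lemma H_eq_1_set: "{(a, b). H a b = 1} = {(1,0), (-1,0), (0,1), (0,-1), (1,-1), (-1,1)}"
proof -
  have "(a, b) \<in> {(1,0), (-1,0), (0,1), (0,-1), (1,-1), (-1,1)}" if "H a b = 1" for a b
  proof -
    have "\<bar>a\<bar> \<le> 1" "\<bar>b\<bar> \<le> 1"
      using abs_le_H[of a b] abs_le_H[of b a] H_commute[of a b] that by auto
    then have "a = -1 \<or> a = 0 \<or> a = 1" "b = -1 \<or> b = 0 \<or> b = 1" by linarith+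
    then show ?thesis using that by (auto simp: H_def)
  qed
  then show ?thesis by (auto simp: H_def)
qed

lemma card_H_eq_1: "card {(a, b). H a b = 1} = 6"
  unfolding H_eq_1_set by simp

section \<open>Squared lengths in \<open>L k\<close>\<close>

lemma norm_Eisenstein: "(cmod (of_int a * 1 + of_int b * \<omega> 1))\<^sup>2 = of_int (H a b)"
  by (simp add: cmod_power2 \<omega>_def H_def power_mult_distrib power_divide)
     (simp add: power2_eq_square field_simps)

text \<open>Put \<open>p = a + b * \<omega> 1\<close> and \<open>q = c + d * \<omega> 1\<close>. As
  \<open>\<omega> k\<close> has modulus 1, the squared length is \<open>H a b + H c d\<close> plus
  twice the inner product of \<open>p\<close> and \<open>q * \<omega> k\<close>. Polarisation turns
  its rational part into values of \<open>H\<close>; the factor \<open>2 * k\<close> clears the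
  denominators of \<open>\<omega> k\<close>.\<close>

lemma norm_vec4:
  assumes "k \<ge> 1"
  shows "2 * real k * (cmod (vec4 k a b c d))\<^sup>2 =
    of_int (H a b + H c d + (2 * int k - 1) * H (a + c) (b + d)) +
    of_int (b * c - a * d) * sqrt (3 * (4 * real k - 1))"
proof -
  define r where "r = sqrt (4 * real k - 1)"
  define x where "x = (2 * real k - 1) / (2 * real k)"
  define y where "y = r / (2 * real k)"
  have k: "real k \<ge> 1" using assms by simp
  have r2: "r * r = 4 * real k - 1" using k by (simp add: r_def)
  have kx: "2 * real k * x = 2 * real k - 1" and ky: "2 * real k * y = r"
    using k by (simp_all add: x_def y_def)
  have "(2 * real k) * (2 * real k) * (x * x + y * y) = (2 * real k) * (2 * real k)"
    using kx ky r2 by algebra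
  then have xy: "x * x + y * y = 1" using k by simp
  define t :: real where "t = sqrt 3"
  have t2: "t * t = 3" by (simp add: t_def)
  define A B C D where "A = real_of_int a" "B = real_of_int b" "C = real_of_int c" "D = real_of_int d"
  note ABCD = this
  \<comment> \<open>Real and imaginary parts: \<open>p = u + iv\<close> and
    \<open>q = w + iz\<close>, while \<open>\<omega> k = x + iy\<close>.\<close>
  define u v w z where "u = A + B / 2" "v = B * t / 2" "w = C + D / 2" "z = D * t / 2"
  note uv = this
  have w: "\<omega> 1 = Complex (1 / 2) (t / 2)" "\<omega> k = Complex x y"
    by (simp_all add: \<omega>_def x_def y_def r_def t_def)
  have "vec4 k a b c d = Complex u v + Complex w z * Complex x y"
    unfolding vec4_def w by (simp add: complex_eq_iff uv ABCD algebra_simps)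
  then have "(cmod (vec4 k a b c d))\<^sup>2 = (u + (w * x - z * y))\<^sup>2 + (v + (w * y + z * x))\<^sup>2"
    by (simp add: cmod_power2)
  also have "\<dots> = (u * u + v * v) + (w * w + z * z) * (x * x + y * y)
      + 2 * x * (u * w + v * z) + 2 * y * (v * w - u * z)"
    by (simp add: power2_eq_square algebra_simps)
  finally have n2: "(cmod (vec4 k a b c d))\<^sup>2 = \<dots>" .
  have "2 * real k * (cmod (vec4 k a b c d))\<^sup>2 =
      2 * real k * ((u * u + v * v) + (w * w + z * z))
      + (2 * real k * x) * (2 * (u * w + v * z)) + (2 * real k * y) * (2 * (v * w - u * z))"
    unfolding n2 xy by (simp add: algebra_simps)
  also have "\<dots> = 2 * real k * ((A\<^sup>2 + A * B + B\<^sup>2) + (C\<^sup>2 + C * D + D\<^sup>2))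
      + (2 * real k - 1) * (2 * A * C + A * D + B * C + 2 * B * D) + (B * C - A * D) * (t * r)"
  proof -
    have e: "u * u + v * v = A * A + A * B + B * B / 4 + B * B * (t * t) / 4"
         "w * w + z * z = C * C + C * D + D * D / 4 + D * D * (t * t) / 4"
         "2 * (u * w + v * z) = 2 * A * C + A * D + B * C + B * D / 2 + B * D * (t * t) / 2"
         "2 * (v * w - u * z) = (B * C - A * D) * t"
      unfolding uv by (simp_all add: algebra_simps add_divide_distrib)
    show ?thesis unfolding kx ky e t2 by (simp add: power2_eq_square algebra_simps)
  qed
  also have "t * r = sqrt (3 * (4 * real k - 1))"
    by (simp only: t_def r_def real_sqrt_mult)
  finally show ?thesis
    by (simp add: H_def ABCD power2_eq_square algebra_simps)
qed

text \<open>Otherwise \<open>3 * (4 * k - 1)\<close> is a rational square, hence the square of an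
  integer \<open>m\<close>. Then 3 divides \<open>m\<close>, and \<open>m = 3 * s\<close> yields
  \<open>4 * k = 3 * s^2 + 1\<close> with \<open>s\<close> odd, an excluded value.\<close>

lemma admissible_independent:
  assumes "admissible k" and eq: "real_of_int X + of_int q * sqrt (3 * (4 * real k - 1)) = 0"
  shows "q = 0"
proof (rule ccontr)
  assume q: "q \<noteq> 0"
  have k: "k \<ge> 1" using assms(1) by (simp add: admissible_def)
  have "(real_of_int X)\<^sup>2 = (of_int q * sqrt (3 * (4 * real k - 1)))\<^sup>2"
    using eq by (simp add: power2_eq_iff)
  also have "\<dots> = real_of_int (q\<^sup>2 * (3 * (4 * int k - 1)))"
    using k by (simp add: power_mult_distrib)
  finally have "real_of_int (X\<^sup>2) = real_of_int (q\<^sup>2 * (3 * (4 * int k - 1)))" by simp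
  then have X2: "X\<^sup>2 = q\<^sup>2 * (3 * (4 * int k - 1))" by (simp only: of_int_eq_iff)
  then have "q\<^sup>2 dvd X\<^sup>2" by simp
  then obtain m where "X = q * m" by (auto elim: dvdE)
  with X2 q have m: "m\<^sup>2 = 3 * (4 * int k - 1)" by (simp add: power_mult_distrib)
  then have "3 dvd m\<^sup>2" by simp
  moreover have "prime (3::int)" by simp
  ultimately have "3 dvd m" using prime_dvd_power by blast
  then obtain s where "m = 3 * s" by blast
  with m have s: "4 * int k = 3 * s\<^sup>2 + 1" by (simp add: power_mult_distrib)
  have "odd s"
  proof
    assume "even s"
    then have "even (3 * s\<^sup>2)" by simp
    moreover have "even (3 * s\<^sup>2 + 1)" unfolding s[symmetric] by simp
    ultimately show False by simp
  qed
  with s assms(1) show False by (auto simp: admissible_def)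
qed

text \<open>The irrational part has to vanish. The case \<open>n = 1\<close> serves for unit
  vectors, \<open>n = 0\<close> for linear independence.\<close>

lemma norm_vec4_eq_int:
  assumes k: "admissible k" and n: "(cmod (vec4 k a b c d))\<^sup>2 = of_int n"
  shows "H a b + H c d + (2 * int k - 1) * H (a + c) (b + d) = 2 * int k * n"
proof -
  let ?Y = "H a b + H c d + (2 * int k - 1) * H (a + c) (b + d)"
  have "k \<ge> 1" using k by (simp add: admissible_def)
  note eq = norm_vec4[OF this, of a b c d, unfolded n]
  then have "real_of_int (?Y - 2 * int k * n) + of_int (b * c - a * d) * sqrt (3 * (4 * real k - 1)) = 0"
    by simp
  from admissible_independent[OF k this] eq
  have "real_of_int (2 * int k * n) = real_of_int ?Y" by simp
  then show ?thesis by (simp only: of_int_eq_iff)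
qed

text \<open>The difference of two equal vectors has length 0, so a sum of nonnegative terms
  vanishes. This is the rank 4 statement.\<close>

lemma vec4_eq_iff:
  assumes k: "admissible k"
  shows "vec4 k a b c d = vec4 k a' b' c' d' \<longleftrightarrow> a = a' \<and> b = b' \<and> c = c' \<and> d = d'"
proof
  assume "vec4 k a b c d = vec4 k a' b' c' d'"
  then have "vec4 k (a - a') (b - b') (c - c') (d - d') = 0"
    by (simp add: vec4_def algebra_simps)
  then have "H (a - a') (b - b') + H (c - c') (d - d')
      + (2 * int k - 1) * H (a - a' + (c - c')) (b - b' + (d - d')) = 0"
    using norm_vec4_eq_int[OF k, of _ _ _ _ 0] by simp
  moreover have "(2 * int k - 1) * H (a - a' + (c - c')) (b - b' + (d - d')) \<ge> 0"
    using k H_nonneg by (simp add: admissible_def)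
  ultimately have "H (a - a') (b - b') = 0" "H (c - c') (d - d') = 0"
    using H_nonneg by (smt (verit))+
  then show "a = a' \<and> b = b' \<and> c = c' \<and> d = d'" by (simp add: H_eq_0_iff)
qed auto

section \<open>Classification and count of the unit vectors\<close>

lemma admissible_ge_2: "admissible k \<Longrightarrow> k \<ge> 2"
  by (cases "k = 1") (auto simp: admissible_def dest: spec[of _ 1])

lemma cmod_vec4_eq_1_iff:
  assumes k: "admissible k"
  shows "cmod (vec4 k a b c d) = 1 \<longleftrightarrow>
    H a b = int k \<and> c = - a \<and> d = - b \<or>
    H a b = 1 \<and> c = 0 \<and> d = 0 \<or> a = 0 \<and> b = 0 \<and> H c d = 1"
    (is "?unit \<longleftrightarrow> ?cases")
proof
  let ?T = "H (a + c) (b + d)"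
  assume ?unit
  then have eq: "H a b + H c d + (2 * int k - 1) * ?T = 2 * int k"
    using norm_vec4_eq_int[OF k, of a b c d 1] by simp
  have k2: "int k \<ge> 2" using admissible_ge_2[OF k] by simp
  \<comment> \<open>Here \<open>k \<ge> 2\<close> matters: \<open>2 * (2 * k - 1)\<close> exceeds
    \<open>2 * k\<close> only for \<open>k > 1\<close>.\<close>
  have "\<not> ?T \<ge> 2"
  proof
    assume "?T \<ge> 2"
    then have "(2 * int k - 1) * 2 \<le> (2 * int k - 1) * ?T"
      using k2 by (intro mult_left_mono) auto
    then show False using eq k2 H_nonneg[of a b] H_nonneg[of c d] by simp
  qed
  then consider "?T = 0" | "?T = 1" using H_nonneg[of "a + c" "b + d"] by linarith
  then show ?cases
  proof cases
    case 1
    then have "c = - a" "d = - b" by (auto simp: H_eq_0_iff)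
    with eq 1 show ?thesis by (simp add: H_minus)
  next
    case 2
    \<comment> \<open>What remains is \<open>2 * k - (2 * k - 1)\<close>, so one of the two vectors
      is zero.\<close>
    with eq have "H a b + H c d = 1" by simp
    then have "H a b = 0 \<and> H c d = 1 \<or> H a b = 1 \<and> H c d = 0"
      using H_nonneg[of a b] H_nonneg[of c d] by linarith
    then show ?thesis by (auto simp: H_eq_0_iff)
  qed
next
  assume ?cases
  have k1: "k \<ge> 1" using k by (simp add: admissible_def)
  have "2 * real k * (cmod (vec4 k a b c d))\<^sup>2 = 2 * real k"
    using \<open>?cases\<close> by (auto simp: norm_vec4[OF k1] H_minus H_eq_0_iff[THEN iffD2])
  then have "(cmod (vec4 k a b c d))\<^sup>2 = 1" using k1 by simp
  then show ?unit by (simp add: power2_eq_1_iff) (smt (verit) norm_ge_zero)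
qed

lemma unit_vectors_eq:
  assumes "admissible k"
  shows "unit_vectors k = {vec4 k a b (- a) (- b) | a b. H a b = int k} \<union>
    ({vec4 k a b 0 0 | a b. H a b = 1} \<union> {vec4 k 0 0 c d | c d. H c d = 1})"
proof -
  have "unit_vectors k = {vec4 k a b c d | a b c d. cmod (vec4 k a b c d) = 1}"
    by (auto simp: unit_vectors_def L_def)
  then show ?thesis unfolding cmod_vec4_eq_1_iff[OF assms] by blast
qed

text \<open>By uniqueness of coordinates a common element would need
  \<open>H 0 0 = 1\<close>.\<close>

lemma vec4_family_disjoint:
  assumes "admissible k"
  shows "{vec4 k a b (- a) (- b) | a b. H a b = int k} \<inter>
    ({vec4 k a b 0 0 | a b. H a b = 1} \<union> {vec4 k 0 0 c d | c d. H c d = 1}) = {}"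
proof -
  have "H 0 0 = 0" by (simp add: H_def)
  then show ?thesis by (auto simp: vec4_eq_iff[OF assms])
qed

lemma bij_betw_vec4_antidiagonal:
  assumes "admissible k"
  shows "bij_betw (\<lambda>(a, b). vec4 k a b (- a) (- b)) {(a, b). H a b = n}
    {vec4 k a b (- a) (- b) | a b. H a b = n}"
  by (auto simp: bij_betw_def inj_on_def vec4_eq_iff[OF assms] image_def)

text \<open>Each family is a copy of the six Eisenstein units, and the two planes share only the
  zero vector.\<close>

lemma card_vec4_axes:
  assumes "admissible k"
  shows "card ({vec4 k a b 0 0 | a b. H a b = 1} \<union> {vec4 k 0 0 c d | c d. H c d = 1}) = 12"
    and "finite ({vec4 k a b 0 0 | a b. H a b = 1} \<union> {vec4 k 0 0 c d | c d. H c d = 1})"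
proof -
  let ?P = "{vec4 k a b 0 0 | a b. H a b = 1}" and ?Q = "{vec4 k 0 0 c d | c d. H c d = 1}"
  have "bij_betw (\<lambda>(a, b). vec4 k a b 0 0) {(a, b). H a b = 1} ?P"
       "bij_betw (\<lambda>(c, d). vec4 k 0 0 c d) {(c, d). H c d = 1} ?Q"
    by (auto simp: bij_betw_def inj_on_def vec4_eq_iff[OF assms] image_def)
  note bij = this
  have "card ?P = 6" "card ?Q = 6" "finite ?P" "finite ?Q"
    using bij[THEN bij_betw_same_card] bij[THEN bij_betw_finite] card_H_eq_1 finite_H_eq[of 1]
    by simp_all
  moreover have "?P \<inter> ?Q = {}" by (auto simp: vec4_eq_iff[OF assms] H_def)
  ultimately show "card (?P \<union> ?Q) = 12" "finite (?P \<union> ?Q)" by (simp_all add: card_Un_disjoint)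
qed

section \<open>Unboundedness of the number of solutions\<close>

lemma admissible_even:
  assumes "k \<ge> 1" "even k"
  shows "admissible k"
proof -
  have False if "odd s" and s: "4 * int k = 3 * s\<^sup>2 + 1" for s
  proof -
    \<comment> \<open>This shows that every excluded value \<open>3 * (t * (t + 1)) + 1\<close> is
      odd.\<close>
    obtain t where "s = 2 * t + 1" using \<open>odd s\<close> by (elim oddE)
    with s have "int k = 3 * (t * (t + 1)) + 1" by (simp add: power2_eq_square algebra_simps)
    moreover have "even (int k)" using assms by simp
    moreover have "even (t * (t + 1))" by simp
    ultimately show False by simp
  qed
  then show ?thesis using assms by (auto simp: admissible_def)
qed

text \<open>The line of slope \<open>1/m\<close> through \<open>(-1, 0)\<close> meets the ellipse \<open>H = 1\<close> again at
  \<open>((m\<^sup>2 - 1)/(m\<^sup>2 + m + 1), (2m + 1)/(m\<^sup>2 + m + 1))\<close>.\<close>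

lemma H_square_param: "H (m\<^sup>2 - 1) (2 * m + 1) = (m\<^sup>2 + m + 1)\<^sup>2"
  by (simp add: H_def power2_eq_square algebra_simps)

text \<open>The second coordinates alone separate the points: the cross-multiplied difference
  factors, and the cofactor of \<open>l - m\<close> is positive.\<close>

lemma square_param_inj:
  fixes l m :: int
  assumes "l \<ge> 1" "m \<ge> 1" and eq: "(2 * m + 1) * (l\<^sup>2 + l + 1) = (2 * l + 1) * (m\<^sup>2 + m + 1)"
  shows "l = m"
proof -
  have "(l - m) * (2 * (m * l) + l + m - 1) = 0"
    using eq by (simp add: power2_eq_square algebra_simps)
  moreover have "m * l > 0" using assms by simp
  ultimately show ?thesis using assms by auto
qed

lemma many_H_solutions:
  "\<exists>k. admissible k \<and> N \<le> card {(a, b). H a b = int k}"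
proof -
  define c :: "int \<Rightarrow> int" where "c m = m\<^sup>2 + m + 1" for m
  \<comment> \<open>The product clears the denominators of the first \<open>N\<close> points, and
    the 2 makes \<open>D^2\<close> even. Below, \<open>f m\<close> is the point with parameter
    \<open>m\<close> scaled by \<open>D\<close>.\<close>
  define D where "D = 2 * (\<Prod>m\<in>{1..int N}. c m)"
  define f where "f m = (D div c m * (m\<^sup>2 - 1), D div c m * (2 * m + 1))" for m
  have c_pos: "c m > 0" if "m \<in> {1..int N}" for m
    using that by (simp add: c_def add_nonneg_pos)
  then have "(\<Prod>m\<in>{1..int N}. c m) > 0" by (intro prod_pos) auto
  then have D_pos: "D > 0" by (simp add: D_def)
  have D_div: "D div c m * c m = D" if "m \<in> {1..int N}" for m
    using that unfolding D_def by (intro dvd_div_mult_self dvd_mult dvd_prodI) auto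
  define k where "k = nat (D\<^sup>2)"
  have k: "int k = D\<^sup>2" by (simp add: k_def)
  have "even (int k)" unfolding k by (simp add: D_def)
  moreover have "int k > 0" unfolding k using D_pos by simp
  ultimately have "admissible k" by (intro admissible_even) auto
  moreover have "N \<le> card {(a, b). H a b = int k}"
  proof -
    have "f ` {1..int N} \<subseteq> {(a, b). H a b = int k}"
    proof (rule image_subsetI)
      fix m assume m: "m \<in> {1..int N}"
      have "H (D div c m * (m\<^sup>2 - 1)) (D div c m * (2 * m + 1)) = (D div c m * c m)\<^sup>2"
        by (simp add: H_scale H_square_param c_def power_mult_distrib)
      then show "f m \<in> {(a, b). H a b = int k}"
        by (simp add: f_def D_div[OF m] k)
    qed
    moreover have "inj_on f {1..int N}"
    proof (rule inj_onI)
      fix l m assume l: "l \<in> {1..int N}" and m: "m \<in> {1..int N}" and "f l = f m"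
      then have e: "D div c l * (2 * l + 1) = D div c m * (2 * m + 1)" by (simp add: f_def)
      \<comment> \<open>Multiplying equal second coordinates by both denominators produces a common
        factor \<open>D\<close>, which then cancels.\<close>
      have "D * ((2 * l + 1) * c m) = (D div c l * c l) * ((2 * l + 1) * c m)"
        by (simp add: D_div[OF l])
      also have "\<dots> = (D div c m * (2 * m + 1)) * c l * c m"
        using e by (simp add: mult_ac)
      also have "\<dots> = (D div c m * c m) * ((2 * m + 1) * c l)" by (simp add: mult_ac)
      also have "\<dots> = D * ((2 * m + 1) * c l)" by (simp add: D_div[OF m])
      finally have "(2 * m + 1) * c l = (2 * l + 1) * c m" using D_pos by simp
      moreover have "l \<ge> 1" "m \<ge> 1" using l m by auto
      ultimately show "l = m" unfolding c_def by (metis square_param_inj)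
    qed
    ultimately have "card {1..int N} \<le> card {(a, b). H a b = int k}"
      by (intro card_inj_on_le finite_H_eq)
    then show ?thesis by simp
  qed
  ultimately show ?thesis by blast
qed

text \<open>The finiteness clauses give the cardinalities their meaning, since \<open>card\<close>
  is 0 on infinite sets.\<close>

theorem theorem2p1:
  "(\<forall>a b :: int. (cmod (of_int a * 1 + of_int b * \<omega> 1))\<^sup>2 = of_int (H a b)) \<and>
   (\<forall>k. admissible k \<longrightarrow>
      (\<forall>a b. H a b = int k \<longrightarrow> vec4 k a b (- a) (- b) \<in> unit_vectors k) \<and>
      unit_vectors k - {vec4 k a b (- a) (- b) | a b. H a b = int k}
        = {vec4 k a b 0 0 | a b. H a b = 1} \<union> {vec4 k 0 0 c d | c d. H c d = 1} \<and>
      card ({vec4 k a b 0 0 | a b. H a b = 1} \<union> {vec4 k 0 0 c d | c d. H c d = 1}) = 12 \<and>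
      finite {(a, b). H a b = int k} \<and>
      finite (unit_vectors k) \<and>
      card (unit_vectors k) = card {(a, b). H a b = int k} + 12) \<and>
   \<not> bdd_above ((\<lambda>k. card {(a, b). H a b = int k}) ` {k. admissible k})"
proof (intro conjI allI impI)
  fix a b :: int
  show "(cmod (of_int a * 1 + of_int b * \<omega> 1))\<^sup>2 = of_int (H a b)" by (rule norm_Eisenstein)
next
  fix k assume k: "admissible k"
  let ?A = "{vec4 k a b (- a) (- b) | a b. H a b = int k}"
  let ?B = "{vec4 k a b 0 0 | a b. H a b = 1} \<union> {vec4 k 0 0 c d | c d. H c d = 1}"
  note U = unit_vectors_eq[OF k] and disj = vec4_family_disjoint[OF k]
  show "vec4 k a b (- a) (- b) \<in> unit_vectors k" if "H a b = int k" for a b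
    using that unfolding U by blast
  show "unit_vectors k - ?A = ?B" unfolding U using disj by blast
  show "card ?B = 12" by (rule card_vec4_axes[OF k])
  show fin: "finite {(a, b). H a b = int k}" by (rule finite_H_eq)
  have A: "card ?A = card {(a, b). H a b = int k}" "finite ?A"
    using bij_betw_vec4_antidiagonal[OF k, of "int k"] fin
    by (auto dest: bij_betw_same_card bij_betw_finite)
  show "finite (unit_vectors k)" unfolding U using A card_vec4_axes[OF k] by simp
  show "card (unit_vectors k) = card {(a, b). H a b = int k} + 12"
    unfolding U by (simp only: card_Un_disjoint[OF A(2) card_vec4_axes(2)[OF k] disj] A(1) card_vec4_axes(1)[OF k])
next
  show "\<not> bdd_above ((\<lambda>k. card {(a, b). H a b = int k}) ` {k. admissible k})"
  proof
    assume "bdd_above ((\<lambda>k. card {(a, b). H a b = int k}) ` {k. admissible k})"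
    then obtain M where "card {(a, b). H a b = int k} \<le> M" if "admissible k" for k
      by (auto simp: bdd_above_def)
    with many_H_solutions[of "Suc M"] show False by fastforce
  qed
qed

end
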